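(* A game $G$ is strongly miserable if and only if there exist two disjoint sets $V'_{0,1}$ and $V'_{1,0}$ of positions satisfying: (i) both sets are independent (there is no move between two positions of the same set); (ii) $V_T\subseteq V'_{0,1}$, where $V_T$ is the set of terminal positions; (iii) every position of $V'_{0,1}\setminus V_T$ has a move to a position of $V'_{1,0}$; (iv) every position of $V'_{1,0}$ has a move to a position of $V'_{0,1}$; (v) for each position $x$ exactly one of the following holds: ($\mathfrak a'$) $x\in V'_{0,1}\cup V'_{1,0}$; ($\mathfrak c'$) $x$ is movable to $V'_{0,1}$ and to $V'_{1,0}$. Moreover, if all these conditions hold then $V'_{0,1}=V_{0,1}$ and $V'_{1,0}=V_{1,0}$.
   Context: A game is a two-player impartial game given by a directed acyclic graph whose vertices are positions and whose arcs are moves, such that from every position only finitely many positions are reachable. A position with no moves is terminal. $\operatorname{mex}(S)$ is the least non-negative integer not in $S$. The normal Sprague–Grundy function is $\mathcal{G}(x)=\operatorname{mex}\{\mathcal{G}(y): x\to y\}$ (so $0$ on terminal positions); the misère Sprague–Grundy function $\mathcal{G}^-$ satisfies $\mathcal{G}^-(x)=1$ for terminal $x$ and $\mathcal{G}^-(x)=\operatorname{mex}\{\mathcal{G}^-(y): x\to y\}$ otherwise. $V_{i,j}$ denotes the set of positions $x$ with $\mathcal{G}(x)=i$ and $\mathcal{G}^-(x)=j$. A position $x$ is movable to a set $W$ if there is a move from $x$ to some position of $W$. A game is strongly miserable if every position $x$ either lies in $V_{0,1}\cup V_{1,0}$ or is movable both to $V_{0,1}$ and to $V_{1,0}$. *)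

theory Defs
  imports "Graph_Theory.Pair_Digraph"
begin

locale game = pair_wf_digraph G for G :: "'a pair_pre_digraph" +
  assumes acyclic_moves: "acyclic (parcs G)"
    and finite_reachable: "x \<in> pverts G \<Longrightarrow> finite {y. x \<rightarrow>\<^sup>*\<^bsub>with_proj G\<^esub> y}"

definition followers :: "'a pair_pre_digraph \<Rightarrow> 'a \<Rightarrow> 'a set" where
  "followers G x = {y. x \<rightarrow>\<^bsub>with_proj G\<^esub> y}"

definition terminals :: "'a pair_pre_digraph \<Rightarrow> 'a set" where
  "terminals G = {x \<in> pverts G. followers G x = {}}"

definition movable :: "'a pair_pre_digraph \<Rightarrow> 'a \<Rightarrow> 'a set \<Rightarrow> bool" where
  "movable G x W \<longleftrightarrow> (\<exists>y\<in>W. x \<rightarrow>\<^bsub>with_proj G\<^esub> y)"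

definition independent_positions :: "'a pair_pre_digraph \<Rightarrow> 'a set \<Rightarrow> bool" where
  "independent_positions G W \<longleftrightarrow> (\<forall>x\<in>W. \<forall>y\<in>W. \<not> x \<rightarrow>\<^bsub>with_proj G\<^esub> y)"

definition mex :: "nat set \<Rightarrow> nat" where
  "mex S = (LEAST n. n \<notin> S)"

text \<open>
  Both Sprague--Grundy functions are defined by well-founded recursion along the moves; the
  recursion is meaningful when \<open>G\<close> is a game. The defining equations of the two functions are
  \<open>grundy_eq\<close>, \<open>misere_grundy_terminal\<close> and \<open>misere_grundy_nonterminal\<close> below.
\<close>

definition grundy :: "'a pair_pre_digraph \<Rightarrow> 'a \<Rightarrow> nat" where
  "grundy G = wfrec ((parcs G)\<inverse>) (\<lambda>g x. mex (g ` followers G x))"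

definition misere_grundy :: "'a pair_pre_digraph \<Rightarrow> 'a \<Rightarrow> nat" where
  "misere_grundy G = wfrec ((parcs G)\<inverse>)
     (\<lambda>g x. if followers G x = {} then 1 else mex (g ` followers G x))"

context game
begin

lemma wf_moves: "wf ((parcs G)\<inverse>)"
proof (rule wf_subset[OF wf_measure])
  let ?R = "\<lambda>x. {y. x \<rightarrow>\<^sup>*\<^bsub>with_proj G\<^esub> y}"
  show "(parcs G)\<inverse> \<subseteq> measure (\<lambda>x. card (?R x))"
  proof clarsimp
    fix x y assume xy: "(x, y) \<in> parcs G"
    then have x: "x \<in> pverts G" by (rule in_arcsD1)
    have "?R y \<subseteq> ?R x"
      using xy by (auto intro: adj_reachable_trans)
    moreover have "x \<in> ?R x" using x by simp
    moreover have "x \<notin> ?R y"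
    proof
      assume "x \<in> ?R y"
      then have "(y, x) \<in> (parcs G)\<^sup>*"
        by (auto dest: reachable_rtranclI)
      with xy have "(x, x) \<in> (parcs G)\<^sup>+" by (rule rtrancl_into_trancl2)
      with acyclic_moves show False by (simp add: acyclic_def)
    qed
    ultimately have "?R y \<subset> ?R x" by blast
    with finite_reachable[OF x] show "card (?R y) < card (?R x)"
      by (rule psubset_card_mono)
  qed
qed

lemma cut_followers: "cut g ((parcs G)\<inverse>) x ` followers G x = g ` followers G x"
  by (rule image_cong) (auto simp: followers_def cut_def)

lemma grundy_eq: "grundy G x = mex {grundy G y | y. x \<rightarrow>\<^bsub>with_proj G\<^esub> y}"
proof -
  have "grundy G x = mex (grundy G ` followers G x)"
    unfolding grundy_def by (subst wfrec[OF wf_moves]) (simp only: cut_followers)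
  then show ?thesis by (simp add: followers_def image_Collect)
qed

lemma misere_grundy_terminal: "x \<in> terminals G \<Longrightarrow> misere_grundy G x = 1"
  unfolding misere_grundy_def by (subst wfrec[OF wf_moves]) (simp add: terminals_def)

lemma misere_grundy_nonterminal:
  assumes "x \<in> pverts G - terminals G"
  shows "misere_grundy G x = mex {misere_grundy G y | y. x \<rightarrow>\<^bsub>with_proj G\<^esub> y}"
proof -
  have ne: "followers G x \<noteq> {}" using assms by (auto simp: terminals_def)
  have "misere_grundy G x = mex (misere_grundy G ` followers G x)"
    unfolding misere_grundy_def
    by (subst wfrec[OF wf_moves]) (simp only: cut_followers ne if_False)
  then show ?thesis by (simp add: followers_def image_Collect)
qed

end

definition sg_class :: "'a pair_pre_digraph \<Rightarrow> nat \<Rightarrow> nat \<Rightarrow> 'a set" where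
  "sg_class G i j = {x \<in> pverts G. grundy G x = i \<and> misere_grundy G x = j}"

definition strongly_miserable :: "'a pair_pre_digraph \<Rightarrow> bool" where
  "strongly_miserable G \<longleftrightarrow>
     (\<forall>x\<in>pverts G. x \<in> sg_class G 0 1 \<union> sg_class G 1 0
        \<or> (movable G x (sg_class G 0 1) \<and> movable G x (sg_class G 1 0)))"

text \<open>
  In \<open>strongly_miserable_witness G A B\<close>, the sets \<open>A\<close> and \<open>B\<close> are the candidates $V'_{0,1}$ and
  $V'_{1,0}$. In the last clause, \<open>P \<longleftrightarrow> \<not> Q\<close> says that exactly one of \<open>P\<close> and \<open>Q\<close> holds.
\<close>

definition strongly_miserable_witness ::
    "'a pair_pre_digraph \<Rightarrow> 'a set \<Rightarrow> 'a set \<Rightarrow> bool" where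
  "strongly_miserable_witness G A B \<longleftrightarrow>
     A \<subseteq> pverts G \<and> B \<subseteq> pverts G \<and> A \<inter> B = {} \<and>
     independent_positions G A \<and> independent_positions G B \<and>
     terminals G \<subseteq> A \<and>
     (\<forall>x \<in> A - terminals G. movable G x B) \<and>
     (\<forall>x \<in> B. movable G x A) \<and>
     (\<forall>x \<in> pverts G. x \<in> A \<union> B \<longleftrightarrow> \<not> (movable G x A \<and> movable G x B))"

end

(* Every arc changes both Sprague-Grundy values, which makes V_{0,1} and V_{1,0} independent, and the
   strong miserability hypothesis forces the mex-witnesses of their positions to lie in the other
   class. Conversely, given a witness (A, B), well-founded induction along the moves shows that the
   pair of Sprague-Grundy values is (0,1) on A, (1,0) on B, and has both entries at least 2
   elsewhere. *)
theory Submission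
  imports Defs
begin

lemma mex_notin:
  assumes "finite S"
  shows "mex S \<notin> S"
  unfolding mex_def using ex_new_if_finite[OF infinite_UNIV_nat assms] by (rule LeastI_ex)

lemma less_mex: "n < mex S \<Longrightarrow> n \<in> S"
  unfolding mex_def using not_less_Least by blast

lemma mex_eqI:
  assumes "n \<notin> S" "\<And>m. m < n \<Longrightarrow> m \<in> S"
  shows "mex S = n"
  unfolding mex_def using assms by (intro Least_equality) (auto simp: not_less[symmetric])

lemma mex_ge_2I:
  assumes "finite S" "0 \<in> S" "1 \<in> S"
  shows "2 \<le> mex S"
proof -
  have "mex S \<noteq> 0" "mex S \<noteq> 1" using mex_notin[OF assms(1)] assms(2,3) by metis+
  then show ?thesis by linarith
qed

context game
begin

lemma move_in_pverts:
  assumes "x \<rightarrow>\<^bsub>with_proj G\<^esub> y"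
  shows "x \<in> pverts G" "y \<in> pverts G"
  using assms by (auto dest: in_arcsD1 in_arcsD2)

lemma terminals_iff: "x \<in> terminals G \<longleftrightarrow> x \<in> pverts G \<and> (\<nexists>y. x \<rightarrow>\<^bsub>with_proj G\<^esub> y)"
  by (auto simp: terminals_def followers_def)

lemma finite_follower_values:
  assumes "x \<in> pverts G"
  shows "finite {f y | y. x \<rightarrow>\<^bsub>with_proj G\<^esub> y}"
proof -
  have "{y. x \<rightarrow>\<^bsub>with_proj G\<^esub> y} \<subseteq> {y. x \<rightarrow>\<^sup>*\<^bsub>with_proj G\<^esub> y}" by auto
  then have "finite {y. x \<rightarrow>\<^bsub>with_proj G\<^esub> y}"
    using finite_reachable[OF assms] by (rule finite_subset)
  then show ?thesis by simp
qed

lemma grundy_terminal: "x \<in> terminals G \<Longrightarrow> grundy G x = 0"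
  by (subst grundy_eq) (auto simp: terminals_iff intro: mex_eqI)

text \<open>A move out of \<open>x\<close> rules out the terminal exception, so the misere function
  obeys the same mex recursion as the normal one.\<close>

lemma misere_grundy_eq:
  assumes "x \<rightarrow>\<^bsub>with_proj G\<^esub> y"
  shows "misere_grundy G x = mex {misere_grundy G y | y. x \<rightarrow>\<^bsub>with_proj G\<^esub> y}"
  using assms move_in_pverts(1)[OF assms]
  by (intro misere_grundy_nonterminal) (auto simp: terminals_iff)

text \<open>The mex of a finite set lies outside it, and a position of a game has only finitely many
  followers. This is the source of all independence facts about the classes.\<close>

lemma grundy_move_neq:
  assumes "x \<rightarrow>\<^bsub>with_proj G\<^esub> y"
  shows "grundy G x \<noteq> grundy G y"
proof -
  have "grundy G x \<notin> {grundy G y | y. x \<rightarrow>\<^bsub>with_proj G\<^esub> y}"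
    using mex_notin[OF finite_follower_values[OF move_in_pverts(1)[OF assms]]]
    by (subst grundy_eq)
  then show ?thesis using assms by blast
qed

lemma misere_grundy_move_neq:
  assumes "x \<rightarrow>\<^bsub>with_proj G\<^esub> y"
  shows "misere_grundy G x \<noteq> misere_grundy G y"
proof -
  have "misere_grundy G x \<notin> {misere_grundy G y | y. x \<rightarrow>\<^bsub>with_proj G\<^esub> y}"
    using mex_notin[OF finite_follower_values[OF move_in_pverts(1)[OF assms]]]
    by (subst misere_grundy_eq[OF assms])
  then show ?thesis using assms by blast
qed

lemma grundy_follower_lessE:
  assumes "n < grundy G x"
  obtains y where "x \<rightarrow>\<^bsub>with_proj G\<^esub> y" "grundy G y = n"
proof -
  have "n \<in> {grundy G y | y. x \<rightarrow>\<^bsub>with_proj G\<^esub> y}"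
    \<comment> \<open>Fixing the equation at \<open>x\<close> keeps rewriting from looping on the
      values under the set binder.\<close>
    by (rule less_mex) (use assms in \<open>simp only: grundy_eq[of x]\<close>)
  then show ?thesis using that by blast
qed

lemma misere_grundy_follower_lessE:
  assumes "x \<in> pverts G - terminals G" "n < misere_grundy G x"
  obtains y where "x \<rightarrow>\<^bsub>with_proj G\<^esub> y" "misere_grundy G y = n"
proof -
  have "n \<in> {misere_grundy G y | y. x \<rightarrow>\<^bsub>with_proj G\<^esub> y}"
    by (rule less_mex) (use assms(2) misere_grundy_nonterminal[OF assms(1)] in simp)
  then show ?thesis using that by blast
qed

text \<open>The substantial clauses are the moves between the two classes. The mex supplies a
  follower of value 0; being unable to move to a class with that same value, it must itself lie in
  one of the classes, and its value decides which.\<close>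

lemma sg_class_witness:
  assumes sm: "strongly_miserable G"
  shows "strongly_miserable_witness G (sg_class G 0 1) (sg_class G 1 0)" (is "strongly_miserable_witness _ ?A ?B")
proof -
  have indep: "independent_positions G (sg_class G i j)" for i j
    using grundy_move_neq by (fastforce simp: independent_positions_def sg_class_def)
  have toB: "movable G x ?B" if x: "x \<in> ?A - terminals G" for x
  proof -
    have "x \<in> pverts G - terminals G" "0 < misere_grundy G x"
      using x by (auto simp: sg_class_def)
    then obtain y where y: "x \<rightarrow>\<^bsub>with_proj G\<^esub> y" "misere_grundy G y = 0"
      by (rule misere_grundy_follower_lessE)
    \<comment> \<open>Such a move would join two positions of misere value 0.\<close>
    have "\<not> movable G y ?B"
      using misere_grundy_move_neq y(2) by (fastforce simp: movable_def sg_class_def)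
    then have "y \<in> ?A \<union> ?B"
      using sm move_in_pverts(2)[OF y(1)] by (auto simp: strongly_miserable_def)
    then have "y \<in> ?B" using y(2) by (auto simp: sg_class_def)
    then show ?thesis using y(1) by (auto simp: movable_def)
  qed
  have toA: "movable G x ?A" if x: "x \<in> ?B" for x
  proof -
    \<comment> \<open>Here the normal function takes over the role that the misere function had in
      \<open>toB\<close>.\<close>
    have "0 < grundy G x" using x by (simp add: sg_class_def)
    then obtain y where y: "x \<rightarrow>\<^bsub>with_proj G\<^esub> y" "grundy G y = 0"
      by (rule grundy_follower_lessE)
    have "\<not> movable G y ?A"
      using grundy_move_neq y(2) by (fastforce simp: movable_def sg_class_def)
    then have "y \<in> ?A \<union> ?B"
      using sm move_in_pverts(2)[OF y(1)] by (auto simp: strongly_miserable_def)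
    then have "y \<in> ?A" using y(2) by (auto simp: sg_class_def)
    then show ?thesis using y(1) by (auto simp: movable_def)
  qed
  have "terminals G \<subseteq> ?A"
    using grundy_terminal misere_grundy_terminal by (auto simp: sg_class_def terminals_iff)
  \<comment> \<open>Strong miserability gives at least one alternative; independence excludes both,
    since a position of a class cannot move into its own class.\<close>
  moreover have "x \<in> ?A \<union> ?B \<longleftrightarrow> \<not> (movable G x ?A \<and> movable G x ?B)" if "x \<in> pverts G" for x
    using sm that indep unfolding strongly_miserable_def independent_positions_def movable_def
    by blast
  ultimately show ?thesis
    using indep toA toB unfolding strongly_miserable_witness_def by (auto simp: sg_class_def)
qed

text \<open>The bound 2 outside \<open>A \<union> B\<close> strengthens the induction: followers
  there contribute neither 0 nor 1 to either mex. It also keeps these positions out of the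
  classes.\<close>

lemma witness_values:
  assumes wit: "strongly_miserable_witness G A B" and "x \<in> pverts G"
  shows "(x \<in> A \<longrightarrow> grundy G x = 0 \<and> misere_grundy G x = 1) \<and>
         (x \<in> B \<longrightarrow> grundy G x = 1 \<and> misere_grundy G x = 0) \<and>
         (x \<notin> A \<union> B \<longrightarrow> 2 \<le> grundy G x \<and> 2 \<le> misere_grundy G x)"
  using assms(2)
proof (induction x rule: wf_induct_rule[OF wf_moves])
  case (1 x)
  let ?S = "{grundy G y | y. x \<rightarrow>\<^bsub>with_proj G\<^esub> y}"
  let ?M = "{misere_grundy G y | y. x \<rightarrow>\<^bsub>with_proj G\<^esub> y}"
  have disj: "A \<inter> B = {}" and indep: "independent_positions G A" "independent_positions G B"
    and toB: "x \<in> A - terminals G \<Longrightarrow> movable G x B"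
    and toA: "x \<in> B \<Longrightarrow> movable G x A"
    and toAB: "x \<notin> A \<union> B \<Longrightarrow> movable G x A \<and> movable G x B"
    using wit 1(2) unfolding strongly_miserable_witness_def by blast+
  have IH: "(y \<in> A \<longrightarrow> grundy G y = 0 \<and> misere_grundy G y = 1) \<and>
         (y \<in> B \<longrightarrow> grundy G y = 1 \<and> misere_grundy G y = 0) \<and>
         (y \<notin> A \<union> B \<longrightarrow> 2 \<le> grundy G y \<and> 2 \<le> misere_grundy G y)"
    if "x \<rightarrow>\<^bsub>with_proj G\<^esub> y" for y
    using 1(1)[of y] that move_in_pverts(2)[OF that] by simp
  \<comment> \<open>\<open>misereA\<close> is proved alongside because the same move shows that
    \<open>x\<close> is not terminal.\<close>
  have inA: "0 \<in> ?S \<and> 1 \<in> ?M" and misereA: "misere_grundy G x = mex ?M" if A: "movable G x A"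
  proof -
    obtain y where y: "y \<in> A" "x \<rightarrow>\<^bsub>with_proj G\<^esub> y" using A by (auto simp: movable_def)
    show "misere_grundy G x = mex ?M" by (rule misere_grundy_eq[OF y(2)])
    have "grundy G y = 0" "misere_grundy G y = 1" using IH[OF y(2)] y(1) by auto
    then show "0 \<in> ?S \<and> 1 \<in> ?M" using y(2) by force
  qed
  have inB: "1 \<in> ?S \<and> 0 \<in> ?M" and misereB: "misere_grundy G x = mex ?M" if B: "movable G x B"
  proof -
    obtain y where y: "y \<in> B" "x \<rightarrow>\<^bsub>with_proj G\<^esub> y" using B by (auto simp: movable_def)
    show "misere_grundy G x = mex ?M" by (rule misere_grundy_eq[OF y(2)])
    have "grundy G y = 1" "misere_grundy G y = 0" using IH[OF y(2)] y(1) by auto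
    then show "1 \<in> ?S \<and> 0 \<in> ?M" using y(2) by force
  qed
  \<comment> \<open>By independence each follower is in \<open>B\<close>, with values (1,0), or
    outside both sets, with values at least 2.\<close>
  have notinA: "0 \<notin> ?S \<and> 1 \<notin> ?M" if "x \<in> A"
  proof -
    have "grundy G y \<noteq> 0 \<and> misere_grundy G y \<noteq> 1" if "x \<rightarrow>\<^bsub>with_proj G\<^esub> y" for y
    proof -
      have "y \<notin> A" using indep(1) \<open>x \<in> A\<close> that by (auto simp: independent_positions_def)
      then show ?thesis using IH[OF that] by (cases "y \<in> B") auto
    qed
    then show ?thesis by force
  qed
  have notinB: "1 \<notin> ?S \<and> 0 \<notin> ?M" if "x \<in> B"
  proof -
    have "grundy G y \<noteq> 1 \<and> misere_grundy G y \<noteq> 0" if "x \<rightarrow>\<^bsub>with_proj G\<^esub> y" for y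
    proof -
      have "y \<notin> B" using indep(2) \<open>x \<in> B\<close> that by (auto simp: independent_positions_def)
      then show ?thesis using IH[OF that] by (cases "y \<in> A") auto
    qed
    then show ?thesis by force
  qed
  have "grundy G x = 0 \<and> misere_grundy G x = 1" if x: "x \<in> A"
  \<comment> \<open>At a terminal position the misere value 1 is the convention; otherwise it is a
    genuine mex, whose required 0 comes from a move to \<open>B\<close>.\<close>
  proof (cases "x \<in> terminals G")
    case True
    then show ?thesis using grundy_terminal misere_grundy_terminal by blast
  next
    case False
    then have B: "movable G x B" using x toB by blast
    have "mex ?S = 0" using notinA[OF x] by (intro mex_eqI) simp_all
    moreover have "mex ?M = 1"
    proof (rule mex_eqI)
      show "1 \<notin> ?M" using notinA[OF x] by blast
      show "m \<in> ?M" if "m < 1" for m using inB[OF B] that by simp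
    qed
    ultimately show ?thesis using grundy_eq[of x] misereB[OF B] by simp
  qed
  moreover have "grundy G x = 1 \<and> misere_grundy G x = 0" if x: "x \<in> B"
  proof -
    have A: "movable G x A" by (rule toA[OF x])
    have "mex ?M = 0" using notinB[OF x] by (intro mex_eqI) simp_all
    moreover have "mex ?S = 1"
    proof (rule mex_eqI)
      show "1 \<notin> ?S" using notinB[OF x] by blast
      show "m \<in> ?S" if "m < 1" for m using inA[OF A] that by simp
    qed
    ultimately show ?thesis using grundy_eq[of x] misereA[OF A] by simp
  qed
  moreover have "2 \<le> grundy G x \<and> 2 \<le> misere_grundy G x" if "x \<notin> A \<union> B"
  proof -
    have AB: "movable G x A" "movable G x B" using toAB[OF that] by blast+
    have "2 \<le> mex ?S" "2 \<le> mex ?M"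
      using inA[OF AB(1)] inB[OF AB(2)] finite_follower_values[OF 1(2)]
      by (blast intro: mex_ge_2I)+
    then show ?thesis using grundy_eq[of x] misereA[OF AB(1)] by simp
  qed
  ultimately show ?case by blast
qed

text \<open>The three cases of \<open>witness_values\<close> have mutually exclusive value pairs, so
  the values of a position determine which case it is in.\<close>

lemma witness_eq_sg_class:
  assumes "strongly_miserable_witness G A B"
  shows "A = sg_class G 0 1" "B = sg_class G 1 0"
proof -
  have sub: "A \<subseteq> pverts G" "B \<subseteq> pverts G"
    using assms by (auto simp: strongly_miserable_witness_def)
  show "A = sg_class G 0 1" "B = sg_class G 1 0"
    using witness_values[OF assms] sub by (fastforce simp: sg_class_def)+
qed

text \<open>Once the classes are identified with \<open>A\<close> and \<open>B\<close>, strong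
  miserability is one half of the exactly-one clause.\<close>

lemma witness_strongly_miserable:
  assumes wit: "strongly_miserable_witness G A B"
  shows "strongly_miserable G"
  using wit unfolding strongly_miserable_def witness_eq_sg_class[OF wit, symmetric]
    strongly_miserable_witness_def by blast

end

theorem theorem4p1:
  fixes G :: "'a pair_pre_digraph"
  assumes "game G"
  shows "(strongly_miserable G \<longleftrightarrow> (\<exists>A B. strongly_miserable_witness G A B))
    \<and> (\<forall>A B. strongly_miserable_witness G A B \<longrightarrow> A = sg_class G 0 1 \<and> B = sg_class G 1 0)"
  using game.sg_class_witness[OF assms] game.witness_strongly_miserable[OF assms]
    game.witness_eq_sg_class[OF assms] by blast

end
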